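(* Fix an integer $m\ge 1$ and indeterminates $x_0,x_1,\ldots,x_m,y,q$. Define the weight sequence $\boldsymbol\alpha=(\alpha_i)_{i\ge m}$ by $$(\alpha_i)_{i\ge m}=(y,\underbrace{x_1,\ldots,x_m}_{m},\,y+x_0,\underbrace{2x_1,\ldots,2x_m}_{m},\,y+2x_0,\underbrace{3x_1,\ldots,3x_m}_{m},\ldots),$$ i.e. $\alpha_{m+(m+1)j}=y+jx_0$ and $\alpha_{m+(m+1)j+i}=(j+1)x_i$ for $j\ge 0$, $1\le i\le m$. Let $S^{(m)}_{n,k}(\boldsymbol\alpha)$ be the entries of the $m$-Stieltjes--Rogers triangle and let $S_n(\boldsymbol\alpha;q)=\sum_{k}S^{(m)}_{n,k}(\boldsymbol\alpha)q^k$ be its row-generating polynomials. Then the sequence $(S_n(\boldsymbol\alpha;q))_{n\ge0}$ is coefficientwise Hankel-totally positive in $(x_0,\ldots,x_m,y,q)$.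
   Context: A partial $m$-Dyck path is a lattice path in $\mathbb{Z}\times\mathbb{N}$ starting on the horizontal axis, using steps $(1,1)$ (rise) and $(1,-m)$ ($m$-fall). Given weights $(\alpha_i)_{i\ge m}$, $S^{(m)}_{n,k}(\boldsymbol\alpha)$ is the generating polynomial of partial $m$-Dyck paths from $(0,0)$ to $((m+1)n,(m+1)k)$ in which each rise has weight $1$ and each $m$-fall starting at height $i$ has weight $\alpha_i$; the lower-triangular array $[S^{(m)}_{n,k}(\boldsymbol\alpha)]_{n,k\ge0}$ is the $m$-Stieltjes--Rogers triangle. A matrix with entries in $\mathbb{R}[\mathbf{z}]$ (for a set of indeterminates $\mathbf z$) is coefficientwise totally positive in $\mathbf z$ if every minor is a polynomial in $\mathbf z$ with nonnegative coefficients. A sequence $(a_n)_{n\ge0}$ in $\mathbb{R}[\mathbf z]$ is coefficientwise Hankel-totally positive in $\mathbf z$ if its Hankel matrix $[a_{i+j}]_{i,j\ge0}$ is coefficientwise totally positive in $\mathbf z$. *)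

theory Defs
  imports
    "HOL-Library.Poly_Mapping"
    "Jordan_Normal_Form.Determinant"
begin

text \<open>
  The ring of polynomials with real coefficients in the indeterminates \<open>'v\<close>: a monomial is a
  finitely supported map from indeterminates to exponents, a polynomial a finitely supported map
  from monomials to coefficients, multiplied by convolution.
\<close>

type_synonym 'v mpoly = "('v \<Rightarrow>\<^sub>0 nat) \<Rightarrow>\<^sub>0 real"

definition indet :: "'v \<Rightarrow> 'v mpoly" where
  "indet v = Poly_Mapping.single (Poly_Mapping.single v 1) 1"

definition nonneg_coeffs :: "'v mpoly \<Rightarrow> bool" where
  "nonneg_coeffs p \<longleftrightarrow> (\<forall>mon. 0 \<le> Poly_Mapping.lookup p mon)"

definition minor :: "(nat \<Rightarrow> nat \<Rightarrow> 'a::comm_ring_1) \<Rightarrow> nat \<Rightarrow> (nat \<Rightarrow> nat) \<Rightarrow> (nat \<Rightarrow> nat) \<Rightarrow> 'a" where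
  "minor A k r c = det (mat k k (\<lambda>(i, j). A (r i) (c j)))"

definition coeffwise_totally_positive :: "(nat \<Rightarrow> nat \<Rightarrow> 'v mpoly) \<Rightarrow> bool" where
  "coeffwise_totally_positive A \<longleftrightarrow>
     (\<forall>k r c. strict_mono_on {..<k} r \<longrightarrow> strict_mono_on {..<k} c \<longrightarrow>
        nonneg_coeffs (minor A k r c))"

definition coeffwise_Hankel_totally_positive :: "(nat \<Rightarrow> 'v mpoly) \<Rightarrow> bool" where
  "coeffwise_Hankel_totally_positive a \<longleftrightarrow> coeffwise_totally_positive (\<lambda>i j. a (i + j))"

definition is_rise :: "int \<times> nat \<Rightarrow> int \<times> nat \<Rightarrow> bool" where
  "is_rise p p' \<longleftrightarrow> fst p' = fst p + 1 \<and> snd p' = snd p + 1"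

text \<open>
  The height condition is written additively since subtraction on the naturals truncates; in
  particular a fall can only start at height at least \<open>m\<close>.
\<close>

definition is_fall :: "nat \<Rightarrow> int \<times> nat \<Rightarrow> int \<times> nat \<Rightarrow> bool" where
  "is_fall m p p' \<longleftrightarrow> fst p' = fst p + 1 \<and> snd p' + m = snd p"

text \<open>A path is represented by the list of its vertices.\<close>

definition partial_Dyck_path :: "nat \<Rightarrow> (int \<times> nat) list \<Rightarrow> bool" where
  "partial_Dyck_path m ps \<longleftrightarrow>
     ps \<noteq> [] \<and> snd (hd ps) = 0 \<and> successively (\<lambda>p p'. is_rise p p' \<or> is_fall m p p') ps"

definition partial_Dyck_paths_between ::
    "nat \<Rightarrow> int \<times> nat \<Rightarrow> int \<times> nat \<Rightarrow> (int \<times> nat) list set" where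
  "partial_Dyck_paths_between m p p' = {ps. partial_Dyck_path m ps \<and> hd ps = p \<and> last ps = p'}"

definition step_weight ::
    "nat \<Rightarrow> (nat \<Rightarrow> 'a::comm_ring_1) \<Rightarrow> int \<times> nat \<Rightarrow> int \<times> nat \<Rightarrow> 'a" where
  "step_weight m \<alpha> p p' = (if is_fall m p p' then \<alpha> (snd p) else 1)"

definition path_weight :: "nat \<Rightarrow> (nat \<Rightarrow> 'a::comm_ring_1) \<Rightarrow> (int \<times> nat) list \<Rightarrow> 'a" where
  "path_weight m \<alpha> ps = (\<Prod>i<length ps - 1. step_weight m \<alpha> (ps ! i) (ps ! Suc i))"

definition Stieltjes_Rogers ::
    "nat \<Rightarrow> (nat \<Rightarrow> 'a::comm_ring_1) \<Rightarrow> nat \<Rightarrow> nat \<Rightarrow> 'a" where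
  "Stieltjes_Rogers m \<alpha> n k =
     (\<Sum>ps\<in>partial_Dyck_paths_between m (0, 0) (int ((m + 1) * n), (m + 1) * k).
        path_weight m \<alpha> ps)"

text \<open>
  The sum stops at \<open>n\<close> because the triangle is lower triangular, as shown in
  \<open>Stieltjes_Rogers_eq_0\<close> below.
\<close>

definition Stieltjes_Rogers_row ::
    "nat \<Rightarrow> (nat \<Rightarrow> 'a::comm_ring_1) \<Rightarrow> 'a \<Rightarrow> nat \<Rightarrow> 'a" where
  "Stieltjes_Rogers_row m \<alpha> q n = (\<Sum>k\<le>n. Stieltjes_Rogers m \<alpha> n k * q ^ k)"

lemma Dyck_steps_nth:
  assumes "successively (\<lambda>p p'. is_rise p p' \<or> is_fall m p p') ps" "i < length ps"
  shows "fst (ps ! i) = fst (hd ps) + int i \<and> snd (ps ! i) \<le> snd (hd ps) + i"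
  using assms(2)
proof (induction i)
  case 0
  then show ?case by (simp add: hd_conv_nth)
next
  case (Suc i)
  then have "is_rise (ps ! i) (ps ! Suc i) \<or> is_fall m (ps ! i) (ps ! Suc i)"
    using assms(1) by (simp add: successively_conv_nth)
  with Suc show ?case by (auto simp: is_rise_def is_fall_def)
qed

lemma partial_Dyck_paths_between_props:
  assumes "ps \<in> partial_Dyck_paths_between m (0, 0) (int l, h)"
  shows "length ps = l + 1" "h \<le> l" "set ps \<subseteq> {0..int l} \<times> {0..l}"
proof -
  have ps: "ps \<noteq> []" "hd ps = (0, 0)" "last ps = (int l, h)"
    and s: "successively (\<lambda>p p'. is_rise p p' \<or> is_fall m p p') ps"
    using assms by (auto simp: partial_Dyck_paths_between_def partial_Dyck_path_def)
  have nth: "fst (ps ! i) = int i \<and> snd (ps ! i) \<le> i" if "i < length ps" for i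
    using Dyck_steps_nth[OF s that] ps by simp
  have "fst (last ps) = int (length ps - 1) \<and> snd (last ps) \<le> length ps - 1"
    using nth[of "length ps - 1"] ps(1) by (simp add: last_conv_nth)
  then show l: "length ps = l + 1" "h \<le> l"
    using ps by (cases ps; simp)+
  show "set ps \<subseteq> {0..int l} \<times> {0..l}"
  proof
    fix p assume "p \<in> set ps"
    then obtain i where "i < length ps" "p = ps ! i" by (auto simp: in_set_conv_nth)
    with nth[of i] l show "p \<in> {0..int l} \<times> {0..l}" by (simp add: mem_Times_iff)
  qed
qed

lemma finite_partial_Dyck_paths_between:
  "finite (partial_Dyck_paths_between m (0, 0) (int l, h))"
proof (rule finite_subset)
  show "partial_Dyck_paths_between m (0, 0) (int l, h)
      \<subseteq> {ps. set ps \<subseteq> {0..int l} \<times> {0..l} \<and> length ps = l + 1}"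
    using partial_Dyck_paths_between_props by blast
  show "finite {ps. set ps \<subseteq> {0..int l} \<times> {0..l} \<and> length ps = l + 1}"
    by (intro finite_lists_length_eq) auto
qed

lemma Stieltjes_Rogers_eq_0:
  assumes "n < k"
  shows "Stieltjes_Rogers m \<alpha> n k = 0"
proof -
  have "partial_Dyck_paths_between m (0, 0) (int ((m + 1) * n), (m + 1) * k) = {}"
    using partial_Dyck_paths_between_props(2)[of _ m "(m + 1) * n" "(m + 1) * k"] assms
    by (metis Suc_eq_plus1 Suc_mult_le_cancel1 equals0I not_le)
  then show ?thesis by (simp add: Stieltjes_Rogers_def)
qed

text \<open>
  \<open>Vx i\<close>, \<open>Vy\<close>, \<open>Vq\<close> name the indeterminates $x_i$, $y$, $q$. For given \<open>m\<close> only
  \<open>Vx 0\<close>, ..., \<open>Vx m\<close> occur.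
\<close>

datatype var = Vx nat | Vy | Vq

text \<open>The values at indices below \<open>m\<close> are irrelevant: no fall starts below height \<open>m\<close>.\<close>

definition alpha :: "nat \<Rightarrow> nat \<Rightarrow> var mpoly" where
  "alpha m l =
     (if l < m then 0
      else let j = (l - m) div (m + 1); i = (l - m) mod (m + 1)
           in if i = 0 then indet Vy + of_nat j * indet (Vx 0)
              else of_nat (j + 1) * indet (Vx i))"

lemma alpha_y: "alpha m (m + (m + 1) * j) = indet Vy + of_nat j * indet (Vx 0)"
  unfolding alpha_def Let_def by (simp del: mult_Suc)

lemma alpha_x:
  assumes "1 \<le> i" "i \<le> m"
  shows "alpha m (m + (m + 1) * j + i) = of_nat (j + 1) * indet (Vx i)"
proof -
  have "(m + (m + 1) * j + i - m) div (m + 1) = j" "(m + (m + 1) * j + i - m) mod (m + 1) = i"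
    using assms by (simp_all del: mult_Suc add: add.assoc)
  then show ?thesis using assms unfolding alpha_def Let_def by simp
qed

end

theory Submission imports Defs begin

text \<open>
  Grouping the steps of a path in blocks of \<open>m + 1\<close> gives, for the row-generating polynomials in a
  variable \<open>z\<close>, the recurrence \<open>S\<^sub>n\<^sub>+\<^sub>1 = (y + z (1 + x\<^sub>0 d/dz)) (1 + x\<^sub>m d/dz) \<dots> (1 + x\<^sub>1 d/dz) S\<^sub>n\<close>. Expanding
  around \<open>z = q\<close> instead of \<open>z = 0\<close> (conjugating the production matrix with a binomial matrix) makes
  \<open>S\<^sub>n(q)\<close> the constant term and only turns the factor \<open>z\<close> into \<open>z + q\<close>. The new production matrix \<open>P\<close>
  is therefore a product of nonnegative matrices whose column supports form a staircase, and right
  multiplication by such a matrix preserves total positivity because the determinant is multilinear.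
  Since \<open>S\<^sub>n(q)\<close> is the corner entry of \<open>P\<^sup>n\<close>, its Hankel matrix arises from the identity matrix by
  finitely many such multiplications.
\<close>

section \<open>Polynomials with nonnegative coefficients\<close>

lemma nonneg_coeffs_0 [simp]: "nonneg_coeffs 0"
  and nonneg_coeffs_1 [simp]: "nonneg_coeffs 1"
  and nonneg_coeffs_indet [simp]: "nonneg_coeffs (indet v)"
  by (simp_all add: nonneg_coeffs_def indet_def lookup_one lookup_single when_def)

lemma nonneg_coeffs_add [simp]: "nonneg_coeffs p \<Longrightarrow> nonneg_coeffs q \<Longrightarrow> nonneg_coeffs (p + q)"
  by (simp add: nonneg_coeffs_def lookup_add)

lemma nonneg_coeffs_mult [simp]:
  assumes "nonneg_coeffs p" "nonneg_coeffs q"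
  shows "nonneg_coeffs (p * q)"
  using assms
  by (auto simp: nonneg_coeffs_def times_poly_mapping.rep_eq prod_fun_def Sum_any.expand_set when_def
      intro!: sum_nonneg mult_nonneg_nonneg)

lemma nonneg_coeffs_of_nat [simp]: "nonneg_coeffs (of_nat n)"
  by (induction n) auto

lemma nonneg_coeffs_sum: "(\<And>i. i \<in> I \<Longrightarrow> nonneg_coeffs (f i)) \<Longrightarrow> nonneg_coeffs (sum f I)"
  by (induction I rule: infinite_finite_induct) auto

lemma nonneg_coeffs_prod: "(\<And>i. i \<in> I \<Longrightarrow> nonneg_coeffs (f i)) \<Longrightarrow> nonneg_coeffs (prod f I)"
  by (induction I rule: infinite_finite_induct) auto

section \<open>Row operators preserving total positivity\<close>

type_synonym 'v row = "nat \<Rightarrow> 'v mpoly"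

definition unit_row :: "nat \<Rightarrow> 'v row" where
  "unit_row i = (\<lambda>j. if i = j then 1 else 0)"

lemma permutes_strict_mono_on_eq_id:
  fixes k :: nat
  assumes "p permutes {0..<k}" "strict_mono_on {0..<k} p"
  shows "p = id"
proof (rule permutes_natset_ge[OF assms(1)], rule ballI)
  fix i assume "i \<in> {0..<k}"
  then show "i \<le> p i"
  proof (induction i)
    case (Suc i)
    then have "p i < p (Suc i)"
      using assms(2) by (auto simp: strict_mono_on_def)
    with Suc show ?case by simp
  qed simp
qed

text \<open>A Leibniz term survives only if \<open>r i = c (p i)\<close> for all
  \<open>i < k\<close>. As \<open>r\<close> and \<open>c\<close> increase, so does \<open>p\<close>;
  hence \<open>p = id\<close> and no sign occurs.\<close>

lemma coeffwise_totally_positive_unit_row: "coeffwise_totally_positive unit_row"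
  unfolding coeffwise_totally_positive_def
proof (intro allI impI)
  fix k and r c :: "nat \<Rightarrow> nat"
  assume r: "strict_mono_on {..<k} r" and c: "strict_mono_on {..<k} c"
  let ?t = "\<lambda>p. signof p * (\<Prod>i = 0..<k. unit_row (r i) (c (p i)) :: 'a mpoly)"
  have "?t p = 0" if "p permutes {0..<k}" "p \<noteq> id" for p
  proof -
    have "\<exists>i<k. r i \<noteq> c (p i)"
    proof (rule ccontr)
      assume "\<not> ?thesis"
      then have eq: "r i = c (p i)" if "i < k" for i using that by blast
      have pk: "p i < k" if "i < k" for i
        using permutes_in_image[OF \<open>p permutes {0..<k}\<close>, of i] that by simp
      have "strict_mono_on {0..<k} p"
      proof (rule strict_mono_onI)
        fix i j assume ij: "i \<in> {0..<k}" "j \<in> {0..<k}" "i < j"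
        then have "c (p i) < c (p j)"
          using r eq by (auto simp: strict_mono_on_def)
        then show "p i < p j"
          using strict_mono_on_less[OF c, of "p i" "p j"] pk ij by simp
      qed
      then show False using permutes_strict_mono_on_eq_id that by blast
    qed
    then have "(\<Prod>i = 0..<k. unit_row (r i) (c (p i)) :: 'a mpoly) = 0"
      by (intro prod_zero) (auto simp: unit_row_def)
    then show ?thesis by simp
  qed
  moreover have "minor unit_row k r c = (\<Sum>p | p permutes {0..<k}. ?t p)"
    unfolding minor_def
    by (subst det_def'[where n = k]) (auto intro!: sum.cong prod.cong simp: permutes_in_image)
  ultimately have "minor unit_row k r c = ?t id"
    by (simp add: sum.remove[of _ id] finite_permutations permutes_id sum.neutral)
  then show "nonneg_coeffs (minor (unit_row :: nat \<Rightarrow> 'a row) k r c)"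
    by (simp add: unit_row_def nonneg_coeffs_prod)
qed

text \<open>
  Such an operator is right multiplication by a matrix whose columns have finite supports
  \<open>S 0\<close>, \<open>S 1\<close>, ..., each lying weakly to the left of the next.
\<close>

definition staircase :: "('v row \<Rightarrow> 'v row) \<Rightarrow> bool" where
  "staircase E \<longleftrightarrow> (\<exists>S b. (\<forall>j. finite (S j)) \<and>
     (\<forall>i j k l. i < j \<longrightarrow> k \<in> S i \<longrightarrow> l \<in> S j \<longrightarrow> k \<le> l) \<and>
     (\<forall>j k. nonneg_coeffs (b j k)) \<and> (\<forall>v j. E v j = (\<Sum>k\<in>S j. b j k * v k)))"

lemma staircaseI:
  assumes "\<And>j. finite (S j)"
    and "\<And>i j k l. i < j \<Longrightarrow> k \<in> S i \<Longrightarrow> l \<in> S j \<Longrightarrow> k \<le> l"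
    and "\<And>j k. nonneg_coeffs (b j k)"
    and "\<And>v j. E v j = (\<Sum>k\<in>S j. b j k * v k)"
  shows "staircase E"
  using assms unfolding staircase_def by (intro exI[of _ S] exI[of _ b]) blast

lemma staircaseE:
  assumes "staircase E"
  obtains S b where "\<And>j. finite (S j)"
    and "\<And>i j k l. i < j \<Longrightarrow> k \<in> S i \<Longrightarrow> l \<in> S j \<Longrightarrow> k \<le> l"
    and "\<And>j k. nonneg_coeffs (b j k)"
    and "\<And>v j. E v j = (\<Sum>k\<in>S j. b j k * v k)"
  using assms unfolding staircase_def by metis

text \<open>Multilinearity of the determinant in its columns: \<open>f\<close> picks one column of
  \<open>A\<close> from the support of each selected column.\<close>

lemma minor_columns_sum:
  fixes A :: "nat \<Rightarrow> nat \<Rightarrow> 'a::comm_ring_1"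
  assumes "\<And>j. finite (S j)"
  shows "minor (\<lambda>i j. \<Sum>l\<in>S j. b j l * A i l) k r c =
    (\<Sum>f\<in>PiE {0..<k} (\<lambda>j. S (c j)). (\<Prod>j = 0..<k. b (c j) (f j)) * minor A k r f)"
proof -
  \<comment> \<open>Transposing makes the products run over columns, which are what is
    expanded.\<close>
  have minor: "minor B k r d = (\<Sum>p | p permutes {0..<k}. signof p * (\<Prod>j = 0..<k. B (r (p j)) (d j)))"
    for B :: "nat \<Rightarrow> nat \<Rightarrow> 'a" and d
  proof -
    have "minor B k r d = det (transpose_mat (mat k k (\<lambda>(i, j). B (r i) (d j))))"
      unfolding minor_def by (rule det_transpose[symmetric, where n = k]) simp
    also have "\<dots> = (\<Sum>p | p permutes {0..<k}. signof p * (\<Prod>j = 0..<k. B (r (p j)) (d j)))"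
      by (subst det_def'[where n = k]) (auto intro!: sum.cong prod.cong simp: permutes_in_image)
    finally show ?thesis .
  qed
  show ?thesis
    by (simp add: minor prod_sum_PiE assms sum_distrib_left prod.distrib mult.left_commute
        sum.swap[of _ "{p. p permutes {0..<k}}"])
qed

text \<open>The staircase condition makes every choice \<open>f\<close> weakly increasing. Either it
  is strictly increasing and gives a minor of \<open>A\<close> without reordering, or a column
  repeats and the determinant vanishes.\<close>

lemma staircase_coeffwise_totally_positive:
  assumes "staircase E" "coeffwise_totally_positive A"
  shows "coeffwise_totally_positive (\<lambda>i. E (A i))"
proof -
  obtain S b where fin: "\<And>j. finite (S j)"
    and le: "\<And>i j k l. i < j \<Longrightarrow> k \<in> S i \<Longrightarrow> l \<in> S j \<Longrightarrow> k \<le> l"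
    and b: "\<And>j k. nonneg_coeffs (b j k)"
    and E: "\<And>v j. E v j = (\<Sum>k\<in>S j. b j k * v k)"
    using assms(1) by (rule staircaseE) blast
  show ?thesis
    unfolding coeffwise_totally_positive_def
  proof (intro allI impI)
    fix k and r c :: "nat \<Rightarrow> nat"
    assume r: "strict_mono_on {..<k} r" and c: "strict_mono_on {..<k} c"
    have "nonneg_coeffs (minor A k r f)" if f: "f \<in> PiE {0..<k} (\<lambda>j. S (c j))" for f
    proof -
      have mono: "f i \<le> f j" if "i < j" "j < k" for i j
      proof (rule le)
        show "c i < c j" using c that by (auto simp: strict_mono_on_def)
        show "f i \<in> S (c i)" "f j \<in> S (c j)" using f that by auto
      qed
      show ?thesis
      proof (cases "inj_on f {..<k}")
        case True
        have "strict_mono_on {..<k} f"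
        proof (rule strict_mono_onI)
          fix i j assume "i \<in> {..<k}" "j \<in> {..<k}" "i < j"
          then show "f i < f j"
            using mono[of i j] inj_onD[OF True, of i j] by (auto simp: le_less)
        qed
        then show ?thesis using assms(2) r by (simp add: coeffwise_totally_positive_def)
      next
        case False
        then obtain i j where "i < k" "j < k" "i \<noteq> j" "f i = f j" by (auto simp: inj_on_def)
        then have "minor A k r f = 0"
          unfolding minor_def
          by (intro det_identical_columns[where i = i and j = j]) (auto simp: col_def)
        then show ?thesis by simp
      qed
    qed
    then show "nonneg_coeffs (minor (\<lambda>i. E (A i)) k r c)"
      unfolding E by (subst minor_columns_sum) (auto intro!: nonneg_coeffs_sum nonneg_coeffs_mult nonneg_coeffs_prod fin b)
  qed
qed

text \<open>Composites are added because staircase form is not preserved by products: two factors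
  with supports \<open>{j, Suc j}\<close> can produce \<open>{j, j + 1, j + 2}\<close>.\<close>

inductive positive_op :: "('v row \<Rightarrow> 'v row) \<Rightarrow> bool" where
  staircase: "staircase E \<Longrightarrow> positive_op E"
| comp: "positive_op E \<Longrightarrow> positive_op F \<Longrightarrow> positive_op (E \<circ> F)"

lemma positive_op_coeffwise_totally_positive:
  "positive_op E \<Longrightarrow> coeffwise_totally_positive A \<Longrightarrow> coeffwise_totally_positive (\<lambda>i. E (A i))"
  by (induction arbitrary: A rule: positive_op.induct)
    (auto intro: staircase_coeffwise_totally_positive)

lemma positive_op_zero: "positive_op E \<Longrightarrow> E (\<lambda>_. 0) = (\<lambda>_. 0)"
  by (induction rule: positive_op.induct) (auto elim!: staircaseE)

lemma positive_op_id: "positive_op id"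
  by (intro positive_op.staircase staircaseI[where S = "\<lambda>j. {j}" and b = "\<lambda>_ _. 1"]) auto

section \<open>Hankel matrices of moments\<close>

text \<open>
  In matrix terms, for the matrix \<open>P\<close> of \<open>E\<close>: \<open>ext E\<close> is the block matrix \<open>1 \<oplus> P\<close>, \<open>merge E\<close> is \<open>P\<close>
  with an extra first row \<open>(1, 0, 0, \<dots>)\<close>, and \<open>split E\<close> is \<open>P\<close> with such an extra first column.
\<close>

definition ext :: "('v row \<Rightarrow> 'v row) \<Rightarrow> 'v row \<Rightarrow> 'v row" where
  "ext E v = case_nat (v 0) (E (\<lambda>k. v (Suc k)))"

definition merge :: "('v row \<Rightarrow> 'v row) \<Rightarrow> 'v row \<Rightarrow> 'v row" where
  "merge E v = (\<lambda>j. E (\<lambda>k. v (Suc k)) j + (if j = 0 then v 0 else 0))"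

definition split :: "('v row \<Rightarrow> 'v row) \<Rightarrow> 'v row \<Rightarrow> 'v row" where
  "split E v = case_nat (v 0) (E v)"

text \<open>The extra row or column attaches to a single factor while the other is only padded by
  \<open>ext\<close>; this reduces closure of \<open>positive_op\<close> to staircase
  factors.\<close>

lemma ext_comp: "ext (E \<circ> F) = ext E \<circ> ext F"
  and merge_comp: "merge (E \<circ> F) = merge E \<circ> ext F"
  and split_comp: "split (E \<circ> F) = ext E \<circ> split F"
  by (simp_all add: fun_eq_iff ext_def merge_def split_def)

lemma
  assumes "staircase E"
  shows staircase_ext: "staircase (ext E)"
    and staircase_merge: "staircase (merge E)"
    and staircase_split: "staircase (split E)"
proof -
  obtain S b where fin: "\<And>j. finite (S j)"
    and le: "\<And>i j k l. i < j \<Longrightarrow> k \<in> S i \<Longrightarrow> l \<in> S j \<Longrightarrow> k \<le> l"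
    and b: "\<And>j k. nonneg_coeffs (b j k)"
    and E: "\<And>v j. E v j = (\<Sum>k\<in>S j. b j k * v k)"
    using assms by (rule staircaseE) blast
  show "staircase (ext E)"
    by (rule staircaseI[where S = "case_nat {0} (\<lambda>j. Suc ` S j)"
          and b = "case_nat (\<lambda>_. 1) (\<lambda>j. case_nat 0 (b j))"])
      (auto simp: fin b ext_def E sum.reindex split: nat.splits intro: le)
  show "staircase (split E)"
    by (rule staircaseI[where S = "case_nat {0} S" and b = "case_nat (\<lambda>_. 1) b"])
      (auto simp: fin b split_def E split: nat.splits intro: le)
  show "staircase (merge E)"
    by (rule staircaseI[where S = "\<lambda>j. (if j = 0 then {0} else {}) \<union> Suc ` S j"
          and b = "\<lambda>j. case_nat 1 (b j)"])
      (auto simp: fin b merge_def E sum.reindex split: nat.splits if_splits intro: le)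
qed

lemma positive_op_ext: "positive_op E \<Longrightarrow> positive_op (ext E)"
proof (induction rule: positive_op.induct)
  case (staircase E)
  then show ?case by (intro positive_op.staircase staircase_ext)
next
  case (comp E F)
  then show ?case unfolding ext_comp by (intro positive_op.comp)
qed

lemma positive_op_merge: "positive_op E \<Longrightarrow> positive_op (merge E)"
proof (induction rule: positive_op.induct)
  case (staircase E)
  then show ?case by (intro positive_op.staircase staircase_merge)
next
  case (comp E F)
  then show ?case unfolding merge_comp by (intro positive_op.comp positive_op_ext)
qed

lemma positive_op_split: "positive_op E \<Longrightarrow> positive_op (split E)"
proof (induction rule: positive_op.induct)
  case (staircase E)
  then show ?case by (intro positive_op.staircase staircase_split)
next
  case (comp E F)
  then show ?case unfolding split_comp by (intro positive_op.comp positive_op_ext)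
qed

text \<open>Induction on \<open>N\<close>: \<open>ext\<close> keeps row 0 and shifts the rows built
  so far, then \<open>merge T\<close> fixes \<open>unit_row 0\<close> and applies one more
  \<open>T\<close> to the others. The bound \<open>N\<close> keeps the number of factors
  finite.\<close>

lemma exists_output_op:
  assumes "positive_op T"
  shows "\<exists>\<Phi>. positive_op \<Phi> \<and> (\<forall>i\<le>N. \<Phi> (unit_row i) = (T ^^ i) (unit_row 0))"
proof (induction N)
  case 0
  show ?case by (intro exI[of _ id] conjI positive_op_id) simp
next
  case (Suc N)
  then obtain \<Phi> where \<Phi>: "positive_op \<Phi>" "\<And>i. i \<le> N \<Longrightarrow> \<Phi> (unit_row i) = (T ^^ i) (unit_row 0)"
    by blast
  have unit: "(\<lambda>k. unit_row (Suc i) (Suc k)) = unit_row i" "unit_row (Suc i) 0 = 0"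
    "(\<lambda>k. unit_row 0 (Suc k)) = (\<lambda>_. 0)" "unit_row 0 0 = 1" for i
    by (simp_all add: unit_row_def)
  have "(merge T \<circ> ext \<Phi>) (unit_row i) = (T ^^ i) (unit_row 0)" if "i \<le> Suc N" for i
  proof (cases i)
    case 0
    then show ?thesis
      by (simp add: fun_eq_iff merge_def ext_def unit positive_op_zero[OF \<Phi>(1)] positive_op_zero[OF assms])
        (simp add: unit_row_def)
  next
    case (Suc n)
    with that \<Phi>(2)[of n] show ?thesis by (simp add: fun_eq_iff merge_def ext_def unit)
  qed
  moreover have "positive_op (merge T \<circ> ext \<Phi>)"
    by (intro positive_op.comp positive_op_merge positive_op_ext assms \<Phi>)
  ultimately show ?case by blast
qed

text \<open>Dually, \<open>split T\<close> saves \<open>v 0\<close> as moment 0 and hands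
  \<open>T v\<close> to the operator for the remaining moments.\<close>

lemma exists_moment_op:
  assumes "positive_op T"
  shows "\<exists>\<Psi>. positive_op \<Psi> \<and> (\<forall>v. \<forall>j\<le>N. \<Psi> v j = (T ^^ j) v 0)"
proof (induction N)
  case 0
  show ?case by (intro exI[of _ id] conjI positive_op_id) simp
next
  case (Suc N)
  then obtain \<Psi> where \<Psi>: "positive_op \<Psi>" "\<And>v j. j \<le> N \<Longrightarrow> \<Psi> v j = (T ^^ j) v 0"
    by blast
  have "(ext \<Psi> \<circ> split T) v j = (T ^^ j) v 0" if "j \<le> Suc N" for v j
    using that by (cases j) (simp_all add: ext_def split_def \<Psi>(2) funpow_swap1)
  moreover have "positive_op (ext \<Psi> \<circ> split T)"
    by (intro positive_op.comp positive_op_split positive_op_ext assms \<Psi>)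
  ultimately show ?case by blast
qed

text \<open>Up to any finite size the Hankel matrix factors as the matrix of rows
  \<open>(T ^^ i) (unit_row 0)\<close> times the matrix reading off
  \<open>(T ^^ j) v 0\<close>.\<close>

lemma coeffwise_Hankel_totally_positive_moments:
  assumes "positive_op T"
  shows "coeffwise_Hankel_totally_positive (\<lambda>n. (T ^^ n) (unit_row 0) 0)"
  unfolding coeffwise_Hankel_totally_positive_def coeffwise_totally_positive_def
proof (intro allI impI)
  fix k and r c :: "nat \<Rightarrow> nat"
  assume rc: "strict_mono_on {..<k} r" "strict_mono_on {..<k} c"
  \<comment> \<open>A crude common bound for all row and column indices of the minor.\<close>
  define N where "N = (\<Sum>i<k. r i + c i)"
  have N: "r i \<le> N" "c i \<le> N" if "i < k" for i
    using member_le_sum[of i "{..<k}" "\<lambda>i. r i + c i"] that unfolding N_def by auto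
  obtain \<Phi> where \<Phi>: "positive_op \<Phi>" "\<And>i. i \<le> N \<Longrightarrow> \<Phi> (unit_row i) = (T ^^ i) (unit_row 0)"
    using exists_output_op[OF assms] by blast
  obtain \<Psi> where \<Psi>: "positive_op \<Psi>" "\<And>v j. j \<le> N \<Longrightarrow> \<Psi> v j = (T ^^ j) v 0"
    using exists_moment_op[OF assms] by blast
  have "coeffwise_totally_positive (\<lambda>i. \<Psi> (\<Phi> (unit_row i)))"
    by (rule positive_op_coeffwise_totally_positive[OF \<Psi>(1)
          positive_op_coeffwise_totally_positive[OF \<Phi>(1) coeffwise_totally_positive_unit_row]])
  then have "nonneg_coeffs (minor (\<lambda>i. \<Psi> (\<Phi> (unit_row i))) k r c)"
    using rc by (simp add: coeffwise_totally_positive_def)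
  also have "minor (\<lambda>i. \<Psi> (\<Phi> (unit_row i))) k r c =
      minor (\<lambda>i j. (T ^^ (i + j)) (unit_row 0) 0) k r c"
    unfolding minor_def
    by (intro arg_cong[where f = det] cong_mat refl)
      (simp add: \<Phi>(2) \<Psi>(2) N funpow_add[symmetric, THEN fun_cong, unfolded o_apply] add.commute)
  finally show "nonneg_coeffs (minor (\<lambda>i j. (T ^^ (i + j)) (unit_row 0) 0) k r c)" .
qed

section \<open>Taylor shifts\<close>

text \<open>The coefficients of \<open>f (z + q)\<close> where \<open>f\<close> has coefficients \<open>v 0, \<dots>, v K\<close>.\<close>

definition taylor_shift :: "'a::comm_semiring_1 \<Rightarrow> nat \<Rightarrow> (nat \<Rightarrow> 'a) \<Rightarrow> nat \<Rightarrow> 'a" where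
  "taylor_shift q K v k = (\<Sum>j\<le>K. v j * of_nat (j choose k) * q ^ (j - k))"

lemma taylor_shift_0: "taylor_shift q K v 0 = (\<Sum>j\<le>K. v j * q ^ j)"
  by (simp add: taylor_shift_def)

lemma taylor_shift_Suc_bound: "v (Suc K) = 0 \<Longrightarrow> taylor_shift q (Suc K) v = taylor_shift q K v"
  by (simp add: taylor_shift_def fun_eq_iff)

lemma taylor_shift_add:
  "taylor_shift q K (\<lambda>j. u j + v j) k = taylor_shift q K u k + taylor_shift q K v k"
  by (simp add: taylor_shift_def distrib_right sum.distrib)

lemma taylor_shift_cmult: "taylor_shift q K (\<lambda>j. a * v j) k = a * taylor_shift q K v k"
  by (simp add: taylor_shift_def sum_distrib_left mult.assoc)

text \<open>Substituting \<open>z + q\<close> commutes with d/dz. The derivative reaches one index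
  past the truncation, hence the vanishing assumption.\<close>

lemma taylor_shift_deriv:
  assumes "v (Suc K) = 0"
  shows "taylor_shift q K (\<lambda>j. of_nat (Suc j) * v (Suc j)) k = of_nat (Suc k) * taylor_shift q K v (Suc k)"
proof -
  have *: "of_nat (Suc j) * v (Suc j) * of_nat (j choose k) * q ^ (j - k) =
      of_nat (Suc k) * (v (Suc j) * of_nat (Suc j choose Suc k) * q ^ (j - k))" for j
  proof -
    have "(of_nat (Suc j) * of_nat (j choose k) :: 'a) = of_nat (Suc k) * of_nat (Suc j choose Suc k)"
      by (metis Suc_times_binomial_eq mult.commute of_nat_mult)
    then show ?thesis
      by (metis (no_types, lifting) mult.assoc mult.commute)
  qed
  have "taylor_shift q K v (Suc k) = taylor_shift q (Suc K) v (Suc k)"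
    using assms by (simp add: taylor_shift_Suc_bound)
  also have "\<dots> = (\<Sum>j\<le>K. v (Suc j) * of_nat (Suc j choose Suc k) * q ^ (j - k))"
    unfolding taylor_shift_def by (subst sum.atMost_Suc_shift) simp
  finally show ?thesis
    by (simp only: taylor_shift_def * sum_distrib_left)
qed

text \<open>The operator z d/dz turns into (z + q) d/dz.\<close>

lemma taylor_shift_index_mult:
  "taylor_shift q K (\<lambda>j. of_nat j * v j) k =
    of_nat k * taylor_shift q K v k + q * (of_nat (Suc k) * taylor_shift q K v (Suc k))"
proof -
  have "of_nat j * v j * of_nat (j choose k) * q ^ (j - k) =
      of_nat k * (v j * of_nat (j choose k) * q ^ (j - k)) +
      q * (of_nat (Suc k) * (v j * of_nat (j choose Suc k) * q ^ (j - Suc k)))" for j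
  proof (cases "k < j")
    case True
    then obtain d where d: "j = Suc (k + d)" by (auto simp: less_iff_Suc_add)
    have "j * (j choose k) = k * (j choose k) + Suc k * (j choose Suc k)"
      using Suc_times_binomial_add[of k d] unfolding d by (simp add: algebra_simps)
    then have "(of_nat j * of_nat (j choose k) :: 'a) =
        of_nat k * of_nat (j choose k) + of_nat (Suc k) * of_nat (j choose Suc k)"
      by (metis of_nat_add of_nat_mult)
    then have "of_nat j * of_nat (j choose k) * (v j * q ^ (j - k)) =
        (of_nat k * of_nat (j choose k) + of_nat (Suc k) * of_nat (j choose Suc k)) * (v j * q ^ (j - k))"
      by simp
    moreover have "q ^ (j - k) = q * q ^ (j - Suc k)" using d by simp
    ultimately show ?thesis by (simp only: algebra_simps)
  next
    case False
    then show ?thesis by (cases "j = k") (simp_all add: mult.assoc binomial_eq_0)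
  qed
  then show ?thesis
    by (simp only: taylor_shift_def sum.distrib sum_distrib_left)
qed

text \<open>Multiplication by \<open>z\<close> turns into multiplication by \<open>z + q\<close>, by
  Pascal's rule; the degree bound grows by one.\<close>

lemma taylor_shift_case_nat:
  "taylor_shift q (Suc K) (case_nat 0 v) k =
    (case k of 0 \<Rightarrow> 0 | Suc k' \<Rightarrow> taylor_shift q K v k') + q * taylor_shift q K v k"
proof -
  have "taylor_shift q (Suc K) (case_nat 0 v) k =
      (\<Sum>j\<le>K. v j * of_nat (Suc j choose k) * q ^ (Suc j - k))"
    unfolding taylor_shift_def by (subst sum.atMost_Suc_shift) simp
  also have "\<dots> = (case k of 0 \<Rightarrow> 0 | Suc k' \<Rightarrow> taylor_shift q K v k') + q * taylor_shift q K v k"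
  proof (cases k)
    case 0
    then show ?thesis by (simp add: taylor_shift_def sum_distrib_left mult_ac)
  next
    case (Suc k')
    have "v j * of_nat (Suc j choose k) * q ^ (Suc j - k) =
        v j * of_nat (j choose k') * q ^ (j - k') + q * (v j * of_nat (j choose k) * q ^ (j - k))" for j
    proof (cases "k \<le> j")
      case True
      then have "q ^ (j - k') = q * q ^ (j - k)"
        unfolding Suc by (metis Suc_diff_le diff_Suc_Suc power_Suc)
      then show ?thesis unfolding Suc by (simp add: algebra_simps)
    qed (simp add: Suc binomial_eq_0)
    then show ?thesis by (simp add: Suc taylor_shift_def sum_distrib_left sum.distrib)
  qed
  finally show ?thesis .
qed

section \<open>Path sums by final height\<close>

text \<open>Arbitrary end points allow a recurrence by single steps; the triangle consists of the
  values at multiples of \<open>m + 1\<close>.\<close>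

definition height_sum :: "nat \<Rightarrow> (nat \<Rightarrow> 'a::comm_ring_1) \<Rightarrow> nat \<Rightarrow> nat \<Rightarrow> 'a" where
  "height_sum m \<alpha> l h =
     (\<Sum>ps\<in>partial_Dyck_paths_between m (0, 0) (int l, h). path_weight m \<alpha> ps)"

lemma height_sum_eq_0: "l < h \<Longrightarrow> height_sum m \<alpha> l h = 0"
  unfolding height_sum_def
  using partial_Dyck_paths_between_props(2)[of _ m l h] by (intro sum.neutral) force

lemma height_sum_0: "height_sum m \<alpha> 0 h = (if h = 0 then 1 else 0)"
proof (cases "h = 0")
  case True
  have "partial_Dyck_paths_between m (0, 0) (0, 0) = {[(0, 0)]}"
  proof (intro Set.set_eqI iffI)
    fix ps assume "ps \<in> partial_Dyck_paths_between m (0, 0) (0, 0)"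
    then show "ps \<in> {[(0, 0)]}"
      using partial_Dyck_paths_between_props(1)[of ps m 0 0]
      by (auto simp: partial_Dyck_paths_between_def length_Suc_conv)
  qed (auto simp: partial_Dyck_paths_between_def partial_Dyck_path_def)
  then show ?thesis using True by (simp add: height_sum_def path_weight_def)
qed (simp add: height_sum_eq_0)

lemma path_weight_snoc:
  assumes "ps \<noteq> []"
  shows "path_weight m \<alpha> (ps @ [p]) = path_weight m \<alpha> ps * step_weight m \<alpha> (last ps) p"
proof -
  obtain n where n: "length ps = Suc n" using assms by (cases ps) auto
  show ?thesis
    using assms by (simp add: path_weight_def n nth_append last_conv_nth)
qed

lemma partial_Dyck_paths_between_Suc:
  "partial_Dyck_paths_between m (0, 0) (int (Suc l), h) =
    (\<Union>h' \<in> {h'. h = Suc h' \<or> h' = h + m}.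
      (\<lambda>ps. ps @ [(int (Suc l), h)]) ` partial_Dyck_paths_between m (0, 0) (int l, h'))"
  (is "?L = ?R")
proof (intro Set.set_eqI iffI)
  fix ps assume ps: "ps \<in> ?L"
  then have len: "length ps = Suc (Suc l)"
    using partial_Dyck_paths_between_props(1)[OF ps] by simp
  then obtain qs p where "ps = qs @ [p]"
    by (cases ps rule: rev_cases) auto
  with len have qs: "ps = qs @ [p]" "qs \<noteq> []" by auto
  then have p: "p = (int (Suc l), h)" and hd: "hd qs = (0, 0)"
    and succ: "successively (\<lambda>p p'. is_rise p p' \<or> is_fall m p p') qs"
    and step: "is_rise (last qs) p \<or> is_fall m (last qs) p"
    using ps by (auto simp: partial_Dyck_paths_between_def partial_Dyck_path_def successively_append_iff)
  obtain h' where h': "last qs = (int l, h')" "h = Suc h' \<or> h' = h + m"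
    using step p by (cases "last qs") (auto simp: is_rise_def is_fall_def)
  then have "qs \<in> partial_Dyck_paths_between m (0, 0) (int l, h')"
    using hd succ qs by (simp add: partial_Dyck_paths_between_def partial_Dyck_path_def)
  then show "ps \<in> ?R" using qs p h' by auto
next
  fix ps assume "ps \<in> ?R"
  then show "ps \<in> ?L"
    by (auto simp: partial_Dyck_paths_between_def partial_Dyck_path_def successively_append_iff
        is_rise_def is_fall_def)
qed

lemma height_sum_Suc:
  "height_sum m \<alpha> (Suc l) h =
    (case h of 0 \<Rightarrow> 0 | Suc h' \<Rightarrow> height_sum m \<alpha> l h') + \<alpha> (h + m) * height_sum m \<alpha> l (h + m)"
proof -
  let ?P = "\<lambda>h'. partial_Dyck_paths_between m (0, 0) (int l, h')"
  let ?w = "\<lambda>h'. step_weight m \<alpha> (int l, h') (int (Suc l), h)"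
  have fin: "finite {h'. h = Suc h' \<or> h' = h + m}"
    by (rule finite_subset[of _ "{h - 1, h + m}"]) auto
  have "height_sum m \<alpha> (Suc l) h =
      (\<Sum>h' | h = Suc h' \<or> h' = h + m.
        \<Sum>ps\<in>(\<lambda>ps. ps @ [(int (Suc l), h)]) ` ?P h'. path_weight m \<alpha> ps)"
    unfolding height_sum_def partial_Dyck_paths_between_Suc
  proof (rule sum.UNION_disjoint[OF fin])
    show "\<forall>i\<in>{h'. h = Suc h' \<or> h' = h + m}. finite ((\<lambda>ps. ps @ [(int (Suc l), h)]) ` ?P i)"
      by (intro ballI finite_imageI finite_partial_Dyck_paths_between)
  qed (auto simp: partial_Dyck_paths_between_def)
  also have "\<dots> = (\<Sum>h' | h = Suc h' \<or> h' = h + m. ?w h' * height_sum m \<alpha> l h')"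
  proof (intro sum.cong refl)
    fix h'
    have "(\<Sum>ps\<in>(\<lambda>ps. ps @ [(int (Suc l), h)]) ` ?P h'. path_weight m \<alpha> ps) =
        (\<Sum>ps\<in>?P h'. path_weight m \<alpha> (ps @ [(int (Suc l), h)]))"
      by (subst sum.reindex) (auto simp: inj_on_def)
    also have "\<dots> = (\<Sum>ps\<in>?P h'. ?w h' * path_weight m \<alpha> ps)"
      by (intro sum.cong refl)
        (auto simp: path_weight_snoc partial_Dyck_paths_between_def partial_Dyck_path_def mult.commute)
    finally show "(\<Sum>ps\<in>(\<lambda>ps. ps @ [(int (Suc l), h)]) ` ?P h'. path_weight m \<alpha> ps) =
        ?w h' * height_sum m \<alpha> l h'"
      by (simp add: height_sum_def sum_distrib_left)
  qed
  also have "\<dots> = (case h of 0 \<Rightarrow> 0 | Suc h' \<Rightarrow> height_sum m \<alpha> l h') +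
      \<alpha> (h + m) * height_sum m \<alpha> l (h + m)"
  proof (cases h)
    case 0
    then have "{h'. h = Suc h' \<or> h' = h + m} = {m}" by auto
    then show ?thesis using 0 by (simp add: step_weight_def is_fall_def)
  next
    case (Suc g)
    then have "{h'. h = Suc h' \<or> h' = h + m} = {g, h + m}" by auto
    then show ?thesis using Suc by (simp add: step_weight_def is_fall_def)
  qed
  finally show ?thesis .
qed

section \<open>The Stieltjes--Rogers recurrence\<close>

definition add_deriv :: "'v mpoly \<Rightarrow> 'v row \<Rightarrow> 'v row" where
  "add_deriv x v = (\<lambda>j. v j + of_nat (Suc j) * x * v (Suc j))"

text \<open>
  On generating functions, the composition \<open>collapse y q \<circ> interleave x\<close> is the operator
  \<open>y + (z + q) (1 + x d/dz)\<close>. A tridiagonal matrix is not of staircase form, but it factors through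
  doubled indices: even positions carry \<open>f\<close> and odd positions carry \<open>f + x f'\<close>.
\<close>

definition interleave :: "'v mpoly \<Rightarrow> 'v row \<Rightarrow> 'v row" where
  "interleave x v = (\<lambda>j. if even j then v (j div 2) else add_deriv x v (j div 2))"

definition collapse :: "'v mpoly \<Rightarrow> 'v mpoly \<Rightarrow> 'v row \<Rightarrow> 'v row" where
  "collapse y q v = (\<lambda>k. y * v (2 * k) + q * v (2 * k + 1) + (case k of 0 \<Rightarrow> 0 | Suc k' \<Rightarrow> v (2 * k' + 1)))"

lemma staircase_add_deriv:
  assumes "nonneg_coeffs x"
  shows "staircase (add_deriv x)"
  by (rule staircaseI[where S = "\<lambda>j. {j, Suc j}" and b = "\<lambda>j k. if k = j then 1 else of_nat (Suc j) * x"])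
    (auto simp: add_deriv_def assms simp del: of_nat_Suc)

lemma staircase_interleave:
  assumes "nonneg_coeffs x"
  shows "staircase (interleave x)"
proof (rule staircaseI[where S = "\<lambda>j. if even j then {j div 2} else {j div 2, Suc (j div 2)}"
      and b = "\<lambda>j k. if k = j div 2 then 1 else of_nat (Suc (j div 2)) * x"])
  fix i j k l :: nat
  assume "i < j" "k \<in> (if even i then {i div 2} else {i div 2, Suc (i div 2)})"
    "l \<in> (if even j then {j div 2} else {j div 2, Suc (j div 2)})"
  then show "k \<le> l" by (auto split: if_splits elim!: evenE oddE)
qed (auto simp: interleave_def add_deriv_def assms simp del: of_nat_Suc)

text \<open>Row entry \<open>k\<close> reads positions 2k-1, 2k and 2k+1, so neighbouring supports
  meet only in an odd end point.\<close>

lemma staircase_collapse: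
  assumes "nonneg_coeffs y" "nonneg_coeffs q"
  shows "staircase (collapse y q)"
proof (rule staircaseI[where S = "\<lambda>k. {2 * k, 2 * k + 1} \<union> (case k of 0 \<Rightarrow> {} | Suc k' \<Rightarrow> {2 * k' + 1})"
      and b = "\<lambda>k j. if j = 2 * k then y else if j = 2 * k + 1 then q else 1"])
  show "collapse y q v k =
      (\<Sum>j\<in>{2 * k, 2 * k + 1} \<union> (case k of 0 \<Rightarrow> {} | Suc k' \<Rightarrow> {2 * k' + 1}).
        (if j = 2 * k then y else if j = 2 * k + 1 then q else 1) * v j)" for v k
    by (cases k) (simp_all add: collapse_def add_ac)
qed (auto simp: assms split: nat.splits)

primrec add_derivs :: "nat \<Rightarrow> var row \<Rightarrow> var row" where
  "add_derivs 0 = id"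
| "add_derivs (Suc r) = add_deriv (indet (Vx (Suc r))) \<circ> add_derivs r"

text \<open>The effect of one block of \<open>m + 1\<close> steps on the Taylor coefficients at
  \<open>z = q\<close>.\<close>

definition SR_op :: "nat \<Rightarrow> var row \<Rightarrow> var row" where
  "SR_op m = collapse (indet Vy) (indet Vq) \<circ> (interleave (indet (Vx 0)) \<circ> add_derivs m)"

lemma positive_op_add_derivs: "positive_op (add_derivs r)"
proof (induction r)
  case 0
  show ?case unfolding add_derivs.simps by (rule positive_op_id)
next
  case (Suc r)
  then show ?case unfolding add_derivs.simps
    by (intro positive_op.comp positive_op.staircase[OF staircase_add_deriv] nonneg_coeffs_indet)
qed

lemma positive_op_SR_op: "positive_op (SR_op m)"
  unfolding SR_op_def
  by (rule positive_op.comp[OF positive_op.staircase[OF staircase_collapse]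
        positive_op.comp[OF positive_op.staircase[OF staircase_interleave] positive_op_add_derivs]])
    (rule nonneg_coeffs_indet)+

lemma taylor_shift_add_deriv:
  assumes "v (Suc K) = 0"
  shows "taylor_shift q K (add_deriv x v) = add_deriv x (taylor_shift q K v)"
proof
  fix k
  have "add_deriv x v = (\<lambda>j. v j + x * (of_nat (Suc j) * v (Suc j)))"
    by (simp add: add_deriv_def mult_ac)
  then show "taylor_shift q K (add_deriv x v) k = add_deriv x (taylor_shift q K v) k"
    by (simp only: taylor_shift_add taylor_shift_cmult taylor_shift_deriv[where v = v, OF assms])
      (simp add: add_deriv_def mult_ac)
qed

text \<open>The last step of a block is z + y + x z d/dz; the shift turns it into y + (z + q) (1 + x
  d/dz).\<close>

lemma taylor_shift_collapse_interleave:
  assumes "v (Suc K) = 0"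
  shows "taylor_shift q (Suc K) (\<lambda>j. case_nat 0 v j + (y + of_nat j * x) * v j) =
    collapse y q (interleave x (taylor_shift q K v))"
proof
  fix k
  have eq: "(\<lambda>j. case_nat 0 v j + (y + of_nat j * x) * v j) =
      (\<lambda>j. case_nat 0 v j + (y * v j + x * (of_nat j * v j)))"
    by (simp add: algebra_simps)
  show "taylor_shift q (Suc K) (\<lambda>j. case_nat 0 v j + (y + of_nat j * x) * v j) k =
      collapse y q (interleave x (taylor_shift q K v)) k"
    unfolding eq taylor_shift_add taylor_shift_cmult taylor_shift_index_mult taylor_shift_case_nat
      taylor_shift_Suc_bound[where v = v, OF assms]
    by (cases k) (simp_all add: collapse_def interleave_def add_deriv_def algebra_simps)
qed

text \<open>
  After \<open>(m + 1) n + r\<close> steps every height is congruent to \<open>r\<close> modulo \<open>m + 1\<close>.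
\<close>

definition residue_sum :: "nat \<Rightarrow> nat \<Rightarrow> nat \<Rightarrow> var row" where
  "residue_sum m n r = (\<lambda>k. height_sum m (alpha m) ((m + 1) * n + r) ((m + 1) * k + r))"

lemma residue_sum_eq_0:
  assumes "n < k"
  shows "residue_sum m n r k = 0"
proof -
  have "(m + 1) * n < (m + 1) * k" using assms by (intro mult_strict_left_mono) auto
  then show ?thesis unfolding residue_sum_def by (intro height_sum_eq_0) linarith
qed

lemma residue_sum_Suc:
  assumes "r < m"
  shows "residue_sum m n (Suc r) = add_deriv (indet (Vx (Suc r))) (residue_sum m n r)"
proof
  fix k
  \<comment> \<open>The fall's starting height, written once to look up its weight and once to show
    its residue \<open>r\<close> and index \<open>Suc k\<close>.\<close>
  have h: "(m + 1) * k + Suc r + m = m + (m + 1) * k + Suc r"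
    "(m + 1) * k + Suc r + m = (m + 1) * Suc k + r" by simp_all
  have "residue_sum m n (Suc r) k = height_sum m (alpha m) (Suc ((m + 1) * n + r)) ((m + 1) * k + Suc r)"
    by (simp add: residue_sum_def)
  also have "\<dots> = residue_sum m n r k + alpha m (m + (m + 1) * k + Suc r) * residue_sum m n r (Suc k)"
    unfolding height_sum_Suc residue_sum_def h(1)[symmetric] h(2) by simp
  also have "\<dots> = add_deriv (indet (Vx (Suc r))) (residue_sum m n r) k"
    using assms by (subst alpha_x) (simp_all add: add_deriv_def)
  finally show "residue_sum m n (Suc r) k = add_deriv (indet (Vx (Suc r))) (residue_sum m n r) k" .
qed

text \<open>A rise from residue \<open>m\<close> enters the next multiple of \<open>m + 1\<close>,
  shifting the index; a fall from \<open>m + (m + 1) * k\<close> keeps the index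
  \<open>k\<close>.\<close>

lemma residue_sum_Suc_0:
  "residue_sum m (Suc n) 0 =
    (\<lambda>k. case_nat 0 (residue_sum m n m) k + (indet Vy + of_nat k * indet (Vx 0)) * residue_sum m n m k)"
proof
  fix k
  have "residue_sum m (Suc n) 0 k = height_sum m (alpha m) (Suc ((m + 1) * n + m)) ((m + 1) * k)"
    by (simp add: residue_sum_def add_ac)
  also have "\<dots> = case_nat 0 (residue_sum m n m) k + alpha m (m + (m + 1) * k) * residue_sum m n m k"
    unfolding height_sum_Suc residue_sum_def add.commute[of m "(m + 1) * k"]
    by (cases k) (simp_all add: add_ac)
  finally show "residue_sum m (Suc n) 0 k =
      case_nat 0 (residue_sum m n m) k + (indet Vy + of_nat k * indet (Vx 0)) * residue_sum m n m k"
    unfolding alpha_y .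
qed

text \<open>All rows of block \<open>n\<close> vanish beyond index \<open>n\<close>, so one
  truncation bound serves its first \<open>m\<close> steps.\<close>

lemma taylor_shift_residue_sum:
  "r \<le> m \<Longrightarrow> taylor_shift q n (residue_sum m n r) = add_derivs r (taylor_shift q n (residue_sum m n 0))"
  by (induction r) (simp_all add: residue_sum_Suc taylor_shift_add_deriv residue_sum_eq_0)

lemma taylor_shift_residue_sum_eq_funpow:
  "taylor_shift (indet Vq) n (residue_sum m n 0) = (SR_op m ^^ n) (unit_row 0)"
proof (induction n)
  case 0
  show ?case
    by (simp add: fun_eq_iff taylor_shift_def residue_sum_def height_sum_0 unit_row_def binomial_eq_0_iff)
next
  case (Suc n)
  have "taylor_shift (indet Vq) (Suc n) (residue_sum m (Suc n) 0) =
      SR_op m (taylor_shift (indet Vq) n (residue_sum m n 0))"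
    unfolding residue_sum_Suc_0
      taylor_shift_collapse_interleave[where v = "residue_sum m n m", OF residue_sum_eq_0[OF lessI]]
      taylor_shift_residue_sum[OF order_refl] SR_op_def comp_apply ..
  with Suc show ?case by simp
qed

text \<open>The constant Taylor coefficient at \<open>q\<close> is the value of the row polynomial
  at \<open>q\<close>.\<close>

lemma Stieltjes_Rogers_row_eq_moment:
  "Stieltjes_Rogers_row m (alpha m) (indet Vq) n = (SR_op m ^^ n) (unit_row 0) 0"
  by (simp add: taylor_shift_residue_sum_eq_funpow[symmetric] taylor_shift_0 residue_sum_def
      Stieltjes_Rogers_row_def Stieltjes_Rogers_def height_sum_def)

theorem theorem1p6:
  fixes m :: nat
  assumes "m \<ge> 1"
  shows "coeffwise_Hankel_totally_positive
           (\<lambda>n. Stieltjes_Rogers_row m (alpha m) (indet Vq) n)"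
  unfolding Stieltjes_Rogers_row_eq_moment
  by (rule coeffwise_Hankel_totally_positive_moments[OF positive_op_SR_op])

end
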